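(* Let $p_0, p:[0,1]\to\mathbb{S}^2$ be any two smooth functions, with TSRVC representations $(x_0,q_0)$ and $(x,q)$ respectively (so $x_0=p_0(0)$, $x=p(0)$). Let $\beta:[0,1]\to\mathbb{S}^2$ be any smooth base-curve with $\beta(0)=x_0$ and $\beta(1)=x$, and let $\gamma\in\Gamma$ be any re-parameterization. Then $$d_\beta(p_0,p)=d_\beta(p_0\circ\gamma,\;p\circ\gamma)=d_\beta\Big(\big(x_0,\;q_0(\gamma(t))\sqrt{\dot\gamma(t)}\big),\;\big(x,\;q(\gamma(t))\sqrt{\dot\gamma(t)}\big)\Big).$$
   Context: $\mathbb{S}^2$ is the unit $2$-sphere in $\mathbb{R}^3$ with the standard Riemannian metric, $|\cdot|$ is the induced norm on tangent spaces, and parallel transport is with respect to the Levi-Civita connection. $\Gamma=\{\gamma\in\mathrm{Diff}([0,1]):\gamma(0)=0,\ \gamma(1)=1\}$ is the set of positive (orientation-preserving) diffeomorphisms of $[0,1]$. TSRVC representation: a smooth function $p:[0,1]\to\mathbb{S}^2$ is represented by the pair $(x,q)$, where $x=p(0)\in\mathbb{S}^2$ and $q:[0,1]\to T_x\mathbb{S}^2$ is the transported square-root velocity curve $$q(t)=\left(\frac{\dot p(t)}{\sqrt{|\dot p(t)|}}\right)^{||}_{p(t)\to x},$$ i.e. the vector $\dot p(t)/\sqrt{|\dot p(t)|}\in T_{p(t)}\mathbb{S}^2$ (understood as $0$ when $\dot p(t)=0$) parallel transported from $p(t)$ back to $x=p(0)$ along the curve $p$ itself. Let $\mathbb{B}_x=\mathbb{L}_2([0,1],T_x\mathbb{S}^2)$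 and $\mathbb{B}=\bigsqcup_{x\in\mathbb{S}^2}\mathbb{B}_x$. For $(x_0,q_0),(x,q)\in\mathbb{B}$ and a curve $\beta:[0,1]\to\mathbb{S}^2$ from $x_0$ to $x$, define $$d_\beta\big((x_0,q_0),(x,q)\big)=\sqrt{\ell_\beta^2+\int_0^1\big|q_{0,\beta(1)}^{||}(t)-q(t)\big|^2\,dt},$$ where $\ell_\beta=\int_0^1|\dot\beta(s)|\,ds$ is the length of $\beta$ and $q_{0,\beta(1)}^{||}(t)\in T_x\mathbb{S}^2$ is the parallel transport of $q_0(t)\in T_{x_0}\mathbb{S}^2$ along $\beta$ from $\beta(0)=x_0$ to $\beta(1)=x$. For smooth functions $p_0,p$ with TSRVC representations $(x_0,q_0)$, $(x,q)$, $d_\beta(p_0,p)$ means $d_\beta((x_0,q_0),(x,q))$. *)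

theory Defs
  imports "HOL-Analysis.Analysis"
begin

text \<open>
  Curves on the closed unit interval are total functions on the reals of which only the values
  on \<open>{0..1}\<close> matter; all derivatives are taken within \<open>{0..1}\<close>, so they are one-sided at the
  end points and insensitive to the values outside the interval.
\<close>

abbreviation velocity :: "(real \<Rightarrow> 'a::real_normed_vector) \<Rightarrow> real \<Rightarrow> 'a" where
  "velocity f t \<equiv> vector_derivative f (at t within {0..1})"

text \<open>Smooth means \<open>C\<^sup>\<infinity>\<close>: \<open>D n\<close> is the \<open>n\<close>-th derivative of \<open>f\<close>.\<close>

definition smooth_on_01 :: "(real \<Rightarrow> 'a::real_normed_vector) \<Rightarrow> bool" where
  "smooth_on_01 f \<longleftrightarrow>
     (\<exists>D :: nat \<Rightarrow> real \<Rightarrow> 'a. D 0 = f \<and>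
        (\<forall>n. \<forall>t\<in>{0..1}. (D n has_vector_derivative D (Suc n) t) (at t within {0..1})))"

definition positive_diffeos_01 :: "(real \<Rightarrow> real) set" where
  "positive_diffeos_01 =
     {\<gamma>. bij_betw \<gamma> {0..1} {0..1} \<and> smooth_on_01 \<gamma> \<and>
          smooth_on_01 (inv_into {0..1} \<gamma>) \<and> \<gamma> 0 = 0 \<and> \<gamma> 1 = 1}"

abbreviation S2 :: "(real ^ 3) set" where
  "S2 \<equiv> sphere 0 1"

definition smooth_S2_curve :: "(real \<Rightarrow> real ^ 3) \<Rightarrow> bool" where
  "smooth_S2_curve p \<longleftrightarrow> smooth_on_01 p \<and> p ` {0..1} \<subseteq> S2"

definition tangent_space :: "real ^ 3 \<Rightarrow> (real ^ 3) set" where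
  "tangent_space x = {v. v \<bullet> x = 0}"

text \<open>
  The metric on the sphere is the restriction of the Euclidean inner product to tangent vectors,
  so its Levi-Civita covariant derivative along a curve is the orthogonal projection of the
  Euclidean derivative onto the tangent space.
\<close>

definition tangential_part :: "real ^ 3 \<Rightarrow> real ^ 3 \<Rightarrow> real ^ 3" where
  "tangential_part x w = w - (w \<bullet> x) *\<^sub>R x"

definition covariant_derivative :: "(real \<Rightarrow> real ^ 3) \<Rightarrow> (real \<Rightarrow> real ^ 3) \<Rightarrow> real \<Rightarrow> real ^ 3" where
  "covariant_derivative c V t = tangential_part (c t) (velocity V t)"

definition parallel_field :: "(real \<Rightarrow> real ^ 3) \<Rightarrow> (real \<Rightarrow> real ^ 3) \<Rightarrow> bool" where
  "parallel_field c V \<longleftrightarrow> V differentiable_on {0..1} \<and>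
     (\<forall>t\<in>{0..1}. V t \<in> tangent_space (c t) \<and> covariant_derivative c V t = 0)"

text \<open>
  Transport along \<open>c\<close> from \<open>c s\<close> to \<open>c t\<close>, for \<open>s\<close> and \<open>t\<close> in \<open>{0..1}\<close> in either order and \<open>v\<close>
  in the tangent space at \<open>c s\<close>.
\<close>

definition parallel_transport ::
    "(real \<Rightarrow> real ^ 3) \<Rightarrow> real \<Rightarrow> real \<Rightarrow> real ^ 3 \<Rightarrow> real ^ 3" where
  "parallel_transport c s t v = (THE w. \<exists>V. parallel_field c V \<and> V s = v \<and> V t = w)"

text \<open>
  Where the velocity of \<open>p\<close> vanishes, the transported vector is \<open>0\<close>, since \<open>0 /\<^sub>R sqrt 0 = 0\<close>.
\<close>

definition tsrvc :: "(real \<Rightarrow> real ^ 3) \<Rightarrow> real \<Rightarrow> real ^ 3" where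
  "tsrvc p t = parallel_transport p t 0 (velocity p t /\<^sub>R sqrt (norm (velocity p t)))"

definition tsrvc_rep :: "(real \<Rightarrow> real ^ 3) \<Rightarrow> (real ^ 3) \<times> (real \<Rightarrow> real ^ 3)" where
  "tsrvc_rep p = (p 0, tsrvc p)"

definition curve_length :: "(real \<Rightarrow> real ^ 3) \<Rightarrow> real" where
  "curve_length \<beta> = integral {0..1} (\<lambda>s. norm (velocity \<beta> s))"

text \<open>
  Elements of the bundle are represented by a base point and a function into its tangent space
  (a representative of the \<open>L\<^sup>2\<close> class). The base points enter only through the requirement that
  \<open>\<beta>\<close> joins them, which is left to the user of the definition.
\<close>

definition bundle_dist :: "(real \<Rightarrow> real ^ 3) \<Rightarrow>
    (real ^ 3) \<times> (real \<Rightarrow> real ^ 3) \<Rightarrow> (real ^ 3) \<times> (real \<Rightarrow> real ^ 3) \<Rightarrow> real" where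
  "bundle_dist \<beta> = (\<lambda>(x\<^sub>0, q\<^sub>0) (x, q).
     sqrt ((curve_length \<beta>)\<^sup>2 +
           integral {0..1} (\<lambda>t. (norm (parallel_transport \<beta> 0 1 (q\<^sub>0 t) - q t))\<^sup>2)))"

definition curve_dist ::
    "(real \<Rightarrow> real ^ 3) \<Rightarrow> (real \<Rightarrow> real ^ 3) \<Rightarrow> (real \<Rightarrow> real ^ 3) \<Rightarrow> real" where
  "curve_dist \<beta> p\<^sub>0 p = bundle_dist \<beta> (tsrvc_rep p\<^sub>0) (tsrvc_rep p)"

end

theory Submission
  imports Defs
begin

text \<open>
  Along a curve in the sphere, the parallel fields are the solutions of the linear equation
  \<open>V' = - (V \<bullet> c') c\<close> that start tangentially, so they exist by Picard iteration; any two of them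
  have constant inner product, so they are determined by one value. If \<open>V\<close> is parallel along \<open>c\<close>
  then \<open>V \<circ> \<gamma>\<close> is parallel along \<open>c \<circ> \<gamma>\<close>, which together with the homogeneity of the transport
  turns \<open>q\<close> into \<open>sqrt \<gamma>' (q \<circ> \<gamma>)\<close>. The factor \<open>\<gamma>'\<close> then comes out of the squared norm and is
  absorbed by the substitution rule.
\<close>

section \<open>Linear differential equations\<close>

text \<open>Compare \<open>W\<close> with an antiderivative of the bound, using the mean value
  inequality on the side of \<open>s\<close> where \<open>t\<close> lies. This is the induction step
  that puts factorials into the Picard estimate; both sides of \<open>s\<close> matter because
  transport also runs backwards in time.\<close>

lemma norm_increment_le_power:
  fixes W g :: "real \<Rightarrow> 'a::real_normed_vector"
  assumes der: "\<And>t. t \<in> {a..b} \<Longrightarrow> (W has_vector_derivative g t) (at t within {a..b})"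
    and bound: "\<And>t. t \<in> {a..b} \<Longrightarrow> norm (g t) \<le> C * \<bar>t - s\<bar> ^ n"
    and s: "s \<in> {a..b}" and t: "t \<in> {a..b}"
  shows "norm (W t - W s) \<le> C * \<bar>t - s\<bar> ^ Suc n / Suc n"
proof -
  have cont: "continuous_on {a..b} W"
    by (rule continuous_on_vector_derivative[OF der])
  have der_at: "(W has_vector_derivative g u) (at u)" if "a < u" "u < b" for u
    using der[of u] that at_within_Icc_at[of a u b] by auto
  consider "t = s" | "s < t" | "t < s" by linarith
  then show ?thesis
  proof cases
    case 1
    then show ?thesis by simp
  next
    case 2
    define \<phi> where "\<phi> u = C * (u - s) ^ Suc n / Suc n" for u
    have "norm (W t - W s) \<le> \<phi> t - \<phi> s"
    proof (rule differentiable_bound_general[OF 2])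
      show "continuous_on {s..t} W"
        using cont by (rule continuous_on_subset) (use s t in auto)
      show "continuous_on {s..t} \<phi>"
        unfolding \<phi>_def by (intro continuous_intros) auto
      fix u assume u: "s < u" "u < t"
      show "(W has_vector_derivative g u) (at u)"
        using der_at u s t by auto
      show "(\<phi> has_vector_derivative C * (u - s) ^ n) (at u)"
        unfolding \<phi>_def has_real_derivative_iff_has_vector_derivative[symmetric]
        by (auto intro!: derivative_eq_intros simp del: power_Suc of_nat_Suc)
      show "norm (g u) \<le> C * (u - s) ^ n"
        using bound[of u] u s t by auto
    qed
    then show ?thesis using 2 by (simp add: \<phi>_def)
  next
    case 3
    define \<phi> where "\<phi> u = - (C * (s - u) ^ Suc n / Suc n)" for u
    have "norm (W s - W t) \<le> \<phi> s - \<phi> t"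
    proof (rule differentiable_bound_general[OF 3])
      show "continuous_on {t..s} W"
        using cont by (rule continuous_on_subset) (use s t in auto)
      show "continuous_on {t..s} \<phi>"
        unfolding \<phi>_def by (intro continuous_intros) auto
      fix u assume u: "t < u" "u < s"
      show "(W has_vector_derivative g u) (at u)"
        using der_at u s t by auto
      show "(\<phi> has_vector_derivative C * (s - u) ^ n) (at u)"
        unfolding \<phi>_def has_real_derivative_iff_has_vector_derivative[symmetric]
        by (auto intro!: derivative_eq_intros simp del: power_Suc of_nat_Suc)
      show "norm (g u) \<le> C * (s - u) ^ n"
        using bound[of u] u s t by (auto simp: abs_minus_commute)
    qed
    then show ?thesis using 3 by (simp add: \<phi>_def norm_minus_commute)
  qed
qed

text \<open>The solution is the series of terms \<open>X 0 = v\<close>, \<open>X (n + 1)\<close> =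
  integral of \<open>A (X n)\<close> from \<open>s\<close>. The n-th term is at most
  \<open>norm v * K ^ n * \<bar>t - s\<bar> ^ n / fact n\<close>, so the series converges uniformly,
  and linearity lets it be differentiated term by term.\<close>

lemma linear_ode_solution_exists:
  fixes A :: "real \<Rightarrow> 'a::banach \<Rightarrow> 'a"
  assumes lin: "\<And>t. t \<in> {a..b} \<Longrightarrow> linear (A t)"
    and bound: "\<And>t w. t \<in> {a..b} \<Longrightarrow> norm (A t w) \<le> K * norm w"
    and cont: "\<And>X. continuous_on {a..b} X \<Longrightarrow> continuous_on {a..b} (\<lambda>t. A t (X t))"
    and s: "s \<in> {a..b}"
  obtains V where "V s = v"
    and "\<And>t. t \<in> {a..b} \<Longrightarrow> (V has_vector_derivative A t (V t)) (at t within {a..b})"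
proof -
  \<comment> \<open>The integral from \<open>s\<close> to \<open>t\<close> is a difference of
    integrals starting at \<open>a\<close>, because the integral over \<open>{s..t}\<close> would be
    0 for \<open>t < s\<close>.\<close>
  define I where "I X t = integral {a..t} (\<lambda>u. A u (X u)) - integral {a..s} (\<lambda>u. A u (X u))" for X t
  have I_deriv: "(I X has_vector_derivative A t (X t)) (at t within {a..b})"
    if "continuous_on {a..b} X" "t \<in> {a..b}" for X t
    using integral_has_vector_derivative[OF cont[OF that(1)] that(2)]
    unfolding I_def by (auto intro!: derivative_eq_intros)
  define X where "X n = (I ^^ n) (\<lambda>_. v)" for n
  define dX where "dX n t = (case n of 0 \<Rightarrow> 0 | Suc m \<Rightarrow> A t (X m t))" for n t
  have X_0: "X 0 = (\<lambda>_. v)" and X_Suc: "X (Suc n) = I (X n)" for n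
    by (auto simp: X_def)
  have X_cont: "continuous_on {a..b} (X n)" for n
  proof (induction n)
    case (Suc n)
    show ?case
      unfolding X_Suc by (rule continuous_on_vector_derivative[OF I_deriv[OF Suc]])
  qed (simp add: X_0)
  have X_deriv: "(X n has_vector_derivative dX n t) (at t within {a..b})" if "t \<in> {a..b}" for n t
    using that I_deriv X_cont by (cases n) (auto simp: X_0 X_Suc dX_def)
  have X_s: "X (Suc n) s = 0" for n
    by (simp add: X_Suc I_def)
  have K_nonneg: "0 \<le> K * norm w" for w :: 'a
    using bound[OF s, of w] norm_ge_zero order_trans by blast
  have X_bound: "norm (X n t) \<le> norm v * K ^ n * \<bar>t - s\<bar> ^ n / fact n" if "t \<in> {a..b}" for n t
    using that
  proof (induction n arbitrary: t)
    case 0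
    then show ?case by (simp add: X_0)
  next
    case (Suc n)
    have "norm (X (Suc n) t - X (Suc n) s)
        \<le> (norm v * K ^ Suc n / fact n) * \<bar>t - s\<bar> ^ Suc n / Suc n"
    proof (rule norm_increment_le_power[where g = "dX (Suc n)", OF X_deriv _ s \<open>t \<in> {a..b}\<close>])
      fix u assume u: "u \<in> {a..b}"
      have "norm (dX (Suc n) u) \<le> K * norm (X n u)"
        using bound[OF u] by (simp add: dX_def)
      also have "\<dots> \<le> K * (norm v * K ^ n * \<bar>u - s\<bar> ^ n / fact n)"
      proof (cases "0 \<le> K")
        case True
        with Suc.IH[OF u] show ?thesis by (rule mult_left_mono)
      next
        \<comment> \<open>A negative \<open>K\<close> is compatible with \<open>bound\<close> only
          if every vector has norm 0, and then both sides vanish.\<close>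
        case False
        then have "norm w = 0" for w :: 'a
          using K_nonneg[of w] by (simp add: zero_le_mult_iff)
        from this[of v] this[of "X n u"] show ?thesis by simp
      qed
      finally show "norm (dX (Suc n) u) \<le> norm v * K ^ Suc n / fact n * \<bar>u - s\<bar> ^ n"
        by (simp add: algebra_simps)
    qed auto
    also have "\<dots> = norm v * K ^ Suc n * \<bar>t - s\<bar> ^ Suc n / fact (Suc n)"
      by (simp add: field_simps)
    finally show ?case by (simp add: X_s)
  qed
  \<comment> \<open>Terms of an exponential series, made independent of \<open>t\<close> by bounding
    the distance to \<open>s\<close> by \<open>b - a\<close>.\<close>
  define M where "M n = norm v * (inverse (fact n) * (\<bar>K\<bar> * (b - a)) ^ n)" for n
  have M_bound: "norm (X n t) \<le> M n" if t: "t \<in> {a..b}" for n t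
  proof -
    have "norm (X n t) \<le> norm v * (K * \<bar>t - s\<bar>) ^ n / fact n"
      using X_bound[OF t] by (simp add: power_mult_distrib algebra_simps)
    also have "\<dots> \<le> norm v * (\<bar>K\<bar> * (b - a)) ^ n / fact n"
    proof -
      have "(K * \<bar>t - s\<bar>) ^ n \<le> \<bar>K * \<bar>t - s\<bar>\<bar> ^ n"
        by (metis abs_ge_self power_abs)
      also have "\<dots> \<le> (\<bar>K\<bar> * (b - a)) ^ n"
        by (rule power_mono) (use s t in \<open>auto simp: abs_mult intro!: mult_left_mono\<close>)
      finally show ?thesis
        by (intro divide_right_mono mult_left_mono) auto
    qed
    finally show ?thesis by (simp add: M_def divide_inverse algebra_simps)
  qed
  define G where "G t = (\<Sum>n. X n t)" for t
  have unif: "uniform_limit {a..b} (\<lambda>n t. \<Sum>i<n. X i t) G sequentially"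
    unfolding G_def
  proof (rule Weierstrass_m_test)
    show "summable M"
      unfolding M_def by (intro summable_mult summable_exp)
  qed (use M_bound in auto)
  have X_sums: "(\<lambda>n. X n t) sums G t" if "t \<in> {a..b}" for t
    using tendsto_uniform_limitI[OF unif that] by (simp add: sums_def)
  \<comment> \<open>Termwise differentiation only yields some pointwise sum \<open>V\<close>. The
    sum \<open>G\<close> is named beforehand because the limit of the derivatives must be stated in
    terms of it; the two agree on the interval.\<close>
  have "\<exists>V. \<forall>t\<in>{a..b}. (\<lambda>n. X n t) sums V t \<and>
      (V has_derivative (\<lambda>h. h *\<^sub>R A t (G t))) (at t within {a..b})"
  proof (rule has_derivative_series[where f' = "\<lambda>n t h. h *\<^sub>R dX n t"])
    show "(X n has_derivative (\<lambda>h. h *\<^sub>R dX n t)) (at t within {a..b})" if "t \<in> {a..b}" for n t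
      using X_deriv[OF that] by (simp add: has_vector_derivative_def)
    fix e :: real assume "e > 0"
    \<comment> \<open>The added 1 keeps the divisor positive when \<open>K\<close> is 0.\<close>
    then have e: "e / (\<bar>K\<bar> + 1) > 0" by simp
    \<comment> \<open>The constant term has derivative 0, so \<open>Suc n\<close> derivatives add up
      to \<open>A t\<close> applied to only \<open>n\<close> terms. Uniform convergence of the
      series thus passes to its derivatives through the bound on \<open>A t\<close>.\<close>
    have sum_dX: "(\<Sum>i<Suc n. h *\<^sub>R dX i t) = h *\<^sub>R A t (\<Sum>i<n. X i t)" if "t \<in> {a..b}" for n t h
      unfolding sum.lessThan_Suc_shift
      by (simp add: dX_def linear_sum[OF lin[OF that]] scaleR_sum_right)
    have "\<forall>\<^sub>F n in sequentially. \<forall>t\<in>{a..b}. dist (\<Sum>i<n. X i t) (G t) < e / (\<bar>K\<bar> + 1)"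
      using uniform_limitD[OF unif e] .
    then have "\<forall>\<^sub>F n in sequentially. \<forall>t\<in>{a..b}. \<forall>h.
        norm ((\<Sum>i<Suc n. h *\<^sub>R dX i t) - h *\<^sub>R A t (G t)) \<le> e * norm h"
    proof (rule eventually_mono, intro ballI allI)
      fix n t and h :: real
      assume close: "\<forall>t\<in>{a..b}. dist (\<Sum>i<n. X i t) (G t) < e / (\<bar>K\<bar> + 1)"
        and t: "t \<in> {a..b}"
      let ?d = "(\<Sum>i<n. X i t) - G t"
      have "norm (A t ?d) \<le> K * norm ?d"
        using bound[OF t] .
      also have "\<dots> \<le> (\<bar>K\<bar> + 1) * norm ?d"
        by (rule mult_right_mono) auto
      also have "\<dots> \<le> e"
        using close t by (auto simp: dist_norm field_simps dest!: bspec[where x = t])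
      finally have "norm (A t ?d) \<le> e" .
      moreover have "(\<Sum>i<Suc n. h *\<^sub>R dX i t) - h *\<^sub>R A t (G t) = h *\<^sub>R A t ?d"
        unfolding sum_dX[OF t] by (simp add: linear_diff[OF lin[OF t]] scaleR_diff_right)
      ultimately show "norm ((\<Sum>i<Suc n. h *\<^sub>R dX i t) - h *\<^sub>R A t (G t)) \<le> e * norm h"
        by (simp add: mult.commute[of e] mult_left_mono)
    qed
    then show "\<forall>\<^sub>F n in sequentially. \<forall>t\<in>{a..b}. \<forall>h.
        norm ((\<Sum>i<n. h *\<^sub>R dX i t) - h *\<^sub>R A t (G t)) \<le> e * norm h"
      by (subst eventually_sequentially_Suc[symmetric])
  qed (use s X_sums in auto)
  then obtain V where V_sums: "\<And>t. t \<in> {a..b} \<Longrightarrow> (\<lambda>n. X n t) sums V t"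
    and V_deriv: "\<And>t. t \<in> {a..b} \<Longrightarrow>
      (V has_derivative (\<lambda>h. h *\<^sub>R A t (G t))) (at t within {a..b})"
    by blast
  show thesis
  proof
    show "V s = v"
    proof (rule sums_unique2[OF V_sums[OF s]])
      have "X n s = 0" if "n \<noteq> 0" for n
        using X_s that by (cases n) auto
      then show "(\<lambda>n. X n s) sums v"
        using sums_finite[of "{0}" "\<lambda>n. X n s"] by (simp add: X_0)
    qed
    show "(V has_vector_derivative A t (V t)) (at t within {a..b})" if "t \<in> {a..b}" for t
      using V_deriv[OF that] sums_unique2[OF V_sums[OF that] X_sums[OF that]]
      by (simp add: has_vector_derivative_def)
  qed
qed

section \<open>Parallel transport\<close>

lemma velocity_eqI:
  fixes f :: "real \<Rightarrow> 'a::euclidean_space"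
  assumes "(f has_vector_derivative f') (at t within {0..1})" "t \<in> {0..1}"
  shows "velocity f t = f'"
  by (rule vector_derivative_within_closed_interval) (use assms in auto)

lemma smooth_on_01_has_velocity:
  fixes f :: "real \<Rightarrow> 'a::euclidean_space"
  assumes "smooth_on_01 f" "t \<in> {0..1}"
  shows "(f has_vector_derivative velocity f t) (at t within {0..1})"
proof -
  obtain D where "D 0 = f"
    and "\<forall>n. \<forall>t\<in>{0..1}. (D n has_vector_derivative D (Suc n) t) (at t within {0..1})"
    using assms(1) unfolding smooth_on_01_def by blast
  with assms(2) have "(f has_vector_derivative D (Suc 0) t) (at t within {0..1})"
    by blast
  then show ?thesis
    by (simp add: differentiableI_vector vector_derivative_works[symmetric])
qed

lemma smooth_on_01_continuous_velocity:
  fixes f :: "real \<Rightarrow> 'a::euclidean_space"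
  assumes "smooth_on_01 f"
  shows "continuous_on {0..1} (velocity f)"
proof -
  obtain D where D0: "D 0 = f" and
    D: "\<And>n t. t \<in> {0..1} \<Longrightarrow> (D n has_vector_derivative D (Suc n) t) (at t within {0..1})"
    using assms unfolding smooth_on_01_def by blast
  have "D 1 t = velocity f t" if "t \<in> {0..1}" for t
    using velocity_eqI[of f "D 1 t" t] D[of t 0] D0 that by simp
  moreover have "continuous_on {0..1} (D 1)"
    by (rule continuous_on_vector_derivative[OF D])
  ultimately show ?thesis
    by (rule continuous_on_eq[rotated])
qed

lemma smooth_S2_curveD:
  assumes "smooth_S2_curve c" "t \<in> {0..1}"
  shows "(c has_vector_derivative velocity c t) (at t within {0..1})" and "c t \<bullet> c t = 1"
proof -
  show "(c has_vector_derivative velocity c t) (at t within {0..1})"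
    using assms unfolding smooth_S2_curve_def by (intro smooth_on_01_has_velocity) auto
  have "c t \<in> S2"
    using assms unfolding smooth_S2_curve_def by blast
  then show "c t \<bullet> c t = 1"
    by (simp add: dot_square_norm)
qed

text \<open>Differentiate the constant function \<open>c u \<bullet> c u\<close>.\<close>

lemma velocity_in_tangent_space:
  assumes c: "smooth_S2_curve c" and t: "t \<in> {0..1}"
  shows "velocity c t \<in> tangent_space (c t)"
proof -
  note c' = smooth_S2_curveD(1)[OF c t]
  have "((\<lambda>u. c u \<bullet> c u) has_vector_derivative
      c t \<bullet> velocity c t + velocity c t \<bullet> c t) (at t within {0..1})"
    by (rule bounded_bilinear.has_vector_derivative[OF bounded_bilinear_inner c' c'])
  moreover have "((\<lambda>u. c u \<bullet> c u) has_vector_derivative 0) (at t within {0..1})"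
    by (rule has_vector_derivative_transform[OF t, where f = "\<lambda>_. 1"])
      (use smooth_S2_curveD(2)[OF c] in auto)
  ultimately have "c t \<bullet> velocity c t + velocity c t \<bullet> c t = 0"
    by (metis t velocity_eqI)
  then show ?thesis
    by (simp add: tangent_space_def inner_commute)
qed

section \<open>Parallel fields along curves in the sphere\<close>

lemma tangential_part_scaleR: "tangential_part x (a *\<^sub>R w) = a *\<^sub>R tangential_part x w"
  by (simp add: tangential_part_def algebra_simps)

lemma parallel_fieldD:
  assumes "parallel_field c V" "t \<in> {0..1}"
  shows "(V has_vector_derivative velocity V t) (at t within {0..1})"
    and "V t \<in> tangent_space (c t)" and "tangential_part (c t) (velocity V t) = 0"
  using assms
  by (auto simp: parallel_field_def covariant_derivative_def differentiable_on_def
      vector_derivative_works)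

lemma parallel_fieldI:
  assumes V: "\<And>t. t \<in> {0..1} \<Longrightarrow> (V has_vector_derivative V' t) (at t within {0..1})"
    and tangent: "\<And>t. t \<in> {0..1} \<Longrightarrow> V t \<in> tangent_space (c t)"
    and normal: "\<And>t. t \<in> {0..1} \<Longrightarrow> tangential_part (c t) (V' t) = 0"
  shows "parallel_field c V"
proof -
  have "V differentiable_on {0..1}"
    using V differentiableI_vector unfolding differentiable_on_def by blast
  moreover have "velocity V t = V' t" if "t \<in> {0..1}" for t
    using velocity_eqI V that by blast
  ultimately show ?thesis
    using tangent normal by (simp add: parallel_field_def covariant_derivative_def)
qed

text \<open>A parallel field has a normal derivative, a multiple of \<open>c\<close>;
  differentiating \<open>V \<bullet> c = 0\<close> shows that the coefficient is
  \<open>- (V \<bullet> c')\<close>. This linear equation is solved in the ambient space, and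
  tangency of the solution is recovered afterwards.\<close>

lemma parallel_field_exists:
  assumes c: "smooth_S2_curve c" and s: "s \<in> {0..1}" and v: "v \<in> tangent_space (c s)"
  obtains V where "parallel_field c V" "V s = v"
proof -
  define A where "A t w = - ((w \<bullet> velocity c t) *\<^sub>R c t)" for t w
  note c' = smooth_S2_curveD(1)[OF c] and c_sphere = smooth_S2_curveD(2)[OF c]
  have cont_c: "continuous_on {0..1} c"
    by (rule continuous_on_vector_derivative[OF c'])
  have cont_c': "continuous_on {0..1} (velocity c)"
    using c smooth_on_01_continuous_velocity unfolding smooth_S2_curve_def by blast
  \<comment> \<open>A bound for the speed also bounds the operator \<open>A t\<close>, since
    \<open>c t\<close> is a unit vector.\<close>
  have "bounded (velocity c ` {0..1})"
    by (intro compact_imp_bounded compact_continuous_image cont_c') simp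
  then obtain K where K: "\<And>t. t \<in> {0..1} \<Longrightarrow> norm (velocity c t) \<le> K"
    unfolding bounded_iff by blast
  obtain V where V_s: "V s = v"
    and V': "\<And>t. t \<in> {0..1} \<Longrightarrow> (V has_vector_derivative A t (V t)) (at t within {0..1})"
  proof (rule linear_ode_solution_exists[of 0 1 A K s v])
    show "linear (A t)" for t
      by (rule linearI) (auto simp: A_def algebra_simps inner_add_left)
    show "norm (A t w) \<le> K * norm w" if t: "t \<in> {0..1}" for t w
    proof -
      have "norm (A t w) = \<bar>w \<bullet> velocity c t\<bar>"
        using c_sphere[OF t] by (simp add: A_def norm_eq_1)
      also have "\<dots> \<le> norm w * norm (velocity c t)"
        by (rule Cauchy_Schwarz_ineq2)
      also have "\<dots> \<le> norm w * K"
        by (intro mult_left_mono K t) simp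
      finally show ?thesis by (simp add: mult.commute)
    qed
    show "continuous_on {0..1} (\<lambda>t. A t (X t))" if "continuous_on {0..1} X" for X
      unfolding A_def by (intro continuous_intros that cont_c cont_c')
  qed (use s in auto)
  \<comment> \<open>The derivative is
    \<open>V \<bullet> c' - (V \<bullet> c') * (c \<bullet> c)\<close>, which vanishes on the unit
    sphere. So \<open>V \<bullet> c\<close> keeps its value at \<open>s\<close>, which is 0 by
    tangency of \<open>v\<close>.\<close>
  have const: "((\<lambda>t. V t \<bullet> c t) has_vector_derivative 0) (at t within {0..1})"
    if t: "t \<in> {0..1}" for t
  proof -
    have "((\<lambda>t. V t \<bullet> c t) has_vector_derivative V t \<bullet> velocity c t + A t (V t) \<bullet> c t)
        (at t within {0..1})"
      by (rule bounded_bilinear.has_vector_derivative[OF bounded_bilinear_inner V'[OF t] c'[OF t]])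
    then show ?thesis
      using c_sphere[OF t] by (simp add: A_def)
  qed
  have tangent: "V t \<in> tangent_space (c t)" if t: "t \<in> {0..1}" for t
  proof -
    obtain k where k: "\<And>t. t \<in> {0..1} \<Longrightarrow> V t \<bullet> c t = k"
      by (rule has_vector_derivative_zero_constant[OF convex_real_interval(5) const that])
    show ?thesis
      using v V_s k[OF s] k[OF t] by (simp add: tangent_space_def)
  qed
  have "parallel_field c V"
    by (rule parallel_fieldI[OF V' tangent])
      (use c_sphere in \<open>auto simp: A_def tangential_part_def\<close>)
  with V_s that show thesis by blast
qed

lemma parallel_field_scaleR:
  assumes "parallel_field c V"
  shows "parallel_field c (\<lambda>t. a *\<^sub>R V t)"
proof (rule parallel_fieldI[where V' = "\<lambda>t. a *\<^sub>R velocity V t"])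
  fix t :: real assume t: "t \<in> {0..1}"
  note V = parallel_fieldD[OF assms t]
  show "((\<lambda>t. a *\<^sub>R V t) has_vector_derivative a *\<^sub>R velocity V t) (at t within {0..1})"
    using V(1) by (auto intro!: derivative_eq_intros)
  show "a *\<^sub>R V t \<in> tangent_space (c t)"
    using V(2) by (simp add: tangent_space_def)
  show "tangential_part (c t) (a *\<^sub>R velocity V t) = 0"
    using V(3) by (simp add: tangential_part_scaleR)
qed

lemma has_vector_derivative_reparam:
  assumes "\<And>t. t \<in> {0..1} \<Longrightarrow> (f has_vector_derivative velocity f t) (at t within {0..1})"
    and "\<gamma> ` {0..1} \<subseteq> {0..1}" "t \<in> {0..1}"
    and "(\<gamma> has_vector_derivative velocity \<gamma> t) (at t within {0..1})"
  shows "((f \<circ> \<gamma>) has_vector_derivative velocity \<gamma> t *\<^sub>R velocity f (\<gamma> t)) (at t within {0..1})"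
proof (rule vector_diff_chain_within[OF assms(4)])
  show "(f has_vector_derivative velocity f (\<gamma> t)) (at (\<gamma> t) within \<gamma> ` {0..1})"
    using assms(1)[of "\<gamma> t"] assms(2,3) has_vector_derivative_within_subset by blast
qed

text \<open>By the chain rule the derivative of \<open>V\<close> is only multiplied by a scalar, so
  it remains normal to the sphere.\<close>

lemma parallel_field_reparam:
  assumes V: "parallel_field c V" and \<gamma>: "smooth_on_01 \<gamma>" "\<gamma> ` {0..1} \<subseteq> {0..1}"
  shows "parallel_field (c \<circ> \<gamma>) (V \<circ> \<gamma>)"
proof (rule parallel_fieldI[where V' = "\<lambda>t. velocity \<gamma> t *\<^sub>R velocity V (\<gamma> t)"])
  fix t :: real assume t: "t \<in> {0..1}"
  then have \<gamma>t: "\<gamma> t \<in> {0..1}" using \<gamma> by blast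
  show "((V \<circ> \<gamma>) has_vector_derivative velocity \<gamma> t *\<^sub>R velocity V (\<gamma> t)) (at t within {0..1})"
    by (intro has_vector_derivative_reparam smooth_on_01_has_velocity parallel_fieldD(1)[OF V] \<gamma> t)
  show "(V \<circ> \<gamma>) t \<in> tangent_space ((c \<circ> \<gamma>) t)"
    using parallel_fieldD(2)[OF V \<gamma>t] by simp
  show "tangential_part ((c \<circ> \<gamma>) t) (velocity \<gamma> t *\<^sub>R velocity V (\<gamma> t)) = 0"
    using parallel_fieldD(3)[OF V \<gamma>t] by (simp add: tangential_part_scaleR)
qed

text \<open>In the product rule each term pairs a tangent vector with a normal derivative, hence
  vanishes.\<close>

lemma parallel_field_inner_constant:
  assumes V: "parallel_field c V" and W: "parallel_field c W"
  obtains k where "\<And>t. t \<in> {0..1} \<Longrightarrow> V t \<bullet> W t = k"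
proof -
  have const: "((\<lambda>t. V t \<bullet> W t) has_vector_derivative 0) (at t within {0..1})" if t: "t \<in> {0..1}" for t
  proof -
    note V' = parallel_fieldD[OF V t] and W' = parallel_fieldD[OF W t]
    have orth: "u \<bullet> w = 0" if "u \<in> tangent_space (c t)" "tangential_part (c t) w = 0" for u w
    proof -
      have "u \<bullet> w = u \<bullet> ((w \<bullet> c t) *\<^sub>R c t)"
        using that(2) by (simp add: tangential_part_def)
      then show ?thesis
        using that(1) by (simp add: tangent_space_def)
    qed
    have "((\<lambda>t. V t \<bullet> W t) has_vector_derivative V t \<bullet> velocity W t + velocity V t \<bullet> W t)
        (at t within {0..1})"
      by (rule bounded_bilinear.has_vector_derivative[OF bounded_bilinear_inner V'(1) W'(1)])
    then show ?thesis
      using orth[OF V'(2) W'(3)] orth[OF W'(2) V'(3)] by (simp add: inner_commute)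
  qed
  show thesis
    by (rule has_vector_derivative_zero_constant[OF convex_real_interval(5) const that])
qed

text \<open>The squared norm of \<open>V - W\<close> expands into three constant inner products, so
  it keeps its value at \<open>s\<close>, which is 0.\<close>

lemma parallel_field_unique:
  assumes V: "parallel_field c V" and W: "parallel_field c W"
    and s: "s \<in> {0..1}" and t: "t \<in> {0..1}" and eq: "V s = W s"
  shows "V t = W t"
proof -
  obtain kVV kVW kWW where "\<And>t. t \<in> {0..1} \<Longrightarrow> V t \<bullet> V t = kVV"
    "\<And>t. t \<in> {0..1} \<Longrightarrow> V t \<bullet> W t = kVW" "\<And>t. t \<in> {0..1} \<Longrightarrow> W t \<bullet> W t = kWW"
    using parallel_field_inner_constant[OF V V] parallel_field_inner_constant[OF V W]
      parallel_field_inner_constant[OF W W] by metis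
  then have "(V t - W t) \<bullet> (V t - W t) = (V s - W s) \<bullet> (V s - W s)"
    using s t by (simp add: inner_diff_left inner_diff_right inner_commute)
  with eq show ?thesis by simp
qed

text \<open>Uniqueness justifies the definite description in \<open>parallel_transport\<close>. From
  here on a transport is computed by exhibiting a single parallel field.\<close>

lemma parallel_transport_eq:
  assumes "parallel_field c V" "s \<in> {0..1}" "t \<in> {0..1}"
  shows "parallel_transport c s t (V s) = V t"
  unfolding parallel_transport_def
proof (rule the_equality)
  show "\<exists>W. parallel_field c W \<and> W s = V s \<and> W t = V t"
    using assms by blast
  fix w assume "\<exists>W. parallel_field c W \<and> W s = V s \<and> W t = w"
  then obtain W where "parallel_field c W" "W s = V s" "W t = w" by blast
  then show "w = V t"
    using parallel_field_unique assms by metis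
qed

text \<open>Tangency of \<open>v\<close> provides a parallel field through it, and its multiple by
  \<open>a\<close> is the field through \<open>a *\<^sub>R v\<close>.\<close>

lemma parallel_transport_scaleR:
  assumes c: "smooth_S2_curve c" and s: "s \<in> {0..1}" and t: "t \<in> {0..1}"
    and v: "v \<in> tangent_space (c s)"
  shows "parallel_transport c s t (a *\<^sub>R v) = a *\<^sub>R parallel_transport c s t v"
proof -
  obtain V where V: "parallel_field c V" "V s = v"
    using parallel_field_exists[OF c s v] .
  show ?thesis
    using parallel_transport_eq[OF V(1) s t]
      parallel_transport_eq[OF parallel_field_scaleR[OF V(1), of a] s t] V(2) by simp
qed

section \<open>Tangency of the transported square-root velocity\<close>

lemma normalized_velocity_in_tangent_space:
  assumes "smooth_S2_curve p" "t \<in> {0..1}"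
  shows "velocity p t /\<^sub>R sqrt (norm (velocity p t)) \<in> tangent_space (p t)"
  using velocity_in_tangent_space[OF assms] by (simp add: tangent_space_def)

text \<open>This makes the homogeneity of transport along a base curve starting at
  \<open>p 0\<close> applicable to the values of \<open>tsrvc p\<close>.\<close>

lemma tsrvc_in_tangent_space:
  assumes p: "smooth_S2_curve p" and t: "t \<in> {0..1}"
  shows "tsrvc p t \<in> tangent_space (p 0)"
proof -
  obtain V where V: "parallel_field p V" "V t = velocity p t /\<^sub>R sqrt (norm (velocity p t))"
    using parallel_field_exists[OF p t normalized_velocity_in_tangent_space[OF p t]] .
  show ?thesis
    using parallel_transport_eq[OF V(1) t, of 0] parallel_fieldD(2)[OF V(1), of 0] V(2)
    by (simp add: tsrvc_def)
qed

section \<open>Reparametrization\<close>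

lemma positive_diffeos_01_range:
  assumes "\<gamma> \<in> positive_diffeos_01"
  shows "\<gamma> ` {0..1} = {0..1}" and "inj_on \<gamma> {0..1}"
  using assms by (auto simp: positive_diffeos_01_def bij_betw_def)

text \<open>The chain rule for the smooth inverse composed with \<open>\<gamma>\<close> excludes the
  value 0. The mean value theorem with the fixed end points gives a point of derivative 1, so by
  continuity a nonpositive value would force a zero.\<close>

lemma positive_diffeos_01_velocity_pos:
  assumes \<gamma>: "\<gamma> \<in> positive_diffeos_01" and t: "t \<in> {0..1}"
  shows "velocity \<gamma> t > 0"
proof -
  define g where "g = inv_into {0..1} \<gamma>"
  have smooth: "smooth_on_01 \<gamma>" "smooth_on_01 g" and ends: "\<gamma> 0 = 0" "\<gamma> 1 = 1"
    using \<gamma> by (auto simp: positive_diffeos_01_def g_def)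
  have g_\<gamma>: "g (\<gamma> u) = u" if "u \<in> {0..1}" for u
    using positive_diffeos_01_range[OF \<gamma>] that by (simp add: g_def)
  have nonzero: "velocity \<gamma> u \<noteq> 0" if u: "u \<in> {0..1}" for u
  proof
    assume 0: "velocity \<gamma> u = 0"
    have "((g \<circ> \<gamma>) has_vector_derivative velocity \<gamma> u *\<^sub>R velocity g (\<gamma> u)) (at u within {0..1})"
      by (intro has_vector_derivative_reparam smooth_on_01_has_velocity smooth u)
        (simp_all add: positive_diffeos_01_range[OF \<gamma>])
    then have "velocity (g \<circ> \<gamma>) u = 0"
      using u 0 by (simp add: velocity_eqI)
    \<comment> \<open>The composition is the identity only on \<open>{0..1}\<close>, which suffices
      for a derivative taken within that interval.\<close>
    moreover have "((g \<circ> \<gamma>) has_vector_derivative 1) (at u within {0..1})"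
      by (rule has_vector_derivative_transform[OF u, where f = "\<lambda>x. x"])
        (use g_\<gamma> in \<open>auto intro: derivative_eq_intros\<close>)
    ultimately show False
      using velocity_eqI[OF _ u] by fastforce
  qed
  have cont: "continuous_on {0..1} (velocity \<gamma>)"
    using smooth_on_01_continuous_velocity smooth(1) by blast
  have "\<exists>u\<in>{0<..<1}. \<gamma> 1 - \<gamma> 0 = (1 - 0) * velocity \<gamma> u"
  proof -
    have "\<exists>u\<in>{0<..<1}. \<gamma> 1 - \<gamma> 0 = (\<lambda>h. h *\<^sub>R velocity \<gamma> u) (1 - 0)"
      using smooth_on_01_has_velocity[OF smooth(1)]
      by (intro mvt_simple) (auto simp: has_vector_derivative_def)
    then show ?thesis by simp
  qed
  then obtain m where "m \<in> {0<..<1}" "\<gamma> 1 - \<gamma> 0 = (1 - 0) * velocity \<gamma> m"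
    by blast
  then have m: "m \<in> {0..1}" "velocity \<gamma> m = 1"
    using ends by auto
  have conn: "connected (velocity \<gamma> ` {0..1})"
    by (intro connected_continuous_image cont) simp
  show ?thesis
  proof (rule ccontr)
    assume "\<not> velocity \<gamma> t > 0"
    then have "0 \<in> velocity \<gamma> ` {0..1}"
      using connectedD_interval[OF conn, of "velocity \<gamma> t" "velocity \<gamma> m" 0] m t by auto
    then show False using nonzero by auto
  qed
qed

text \<open>Scaling a velocity by \<open>a > 0\<close> scales its quotient by the square root of its
  norm by \<open>sqrt a\<close>. The transport runs from time \<open>t\<close> to 0 along
  \<open>p \<circ> \<gamma>\<close>, which matches the one from \<open>\<gamma> t\<close> to
  \<open>\<gamma> 0 = 0\<close> along \<open>p\<close>.\<close>

lemma tsrvc_reparam: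
  assumes p: "smooth_S2_curve p" and \<gamma>: "\<gamma> \<in> positive_diffeos_01" and t: "t \<in> {0..1}"
  shows "tsrvc (p \<circ> \<gamma>) t = sqrt (velocity \<gamma> t) *\<^sub>R tsrvc p (\<gamma> t)"
proof -
  let ?a = "velocity \<gamma> t" and ?u = "velocity p (\<gamma> t)"
  have smooth: "smooth_on_01 \<gamma>" and "\<gamma> 0 = 0"
    using \<gamma> by (auto simp: positive_diffeos_01_def)
  have range: "\<gamma> ` {0..1} \<subseteq> {0..1}"
    using positive_diffeos_01_range[OF \<gamma>] by simp
  with t have \<gamma>t: "\<gamma> t \<in> {0..1}" by blast
  have a: "?a > 0"
    using positive_diffeos_01_velocity_pos[OF \<gamma> t] .
  have "velocity (p \<circ> \<gamma>) t = ?a *\<^sub>R ?u"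
    by (intro velocity_eqI has_vector_derivative_reparam smooth_on_01_has_velocity
        smooth_S2_curveD(1)[OF p] smooth range t)
  then have vel: "velocity (p \<circ> \<gamma>) t /\<^sub>R sqrt (norm (velocity (p \<circ> \<gamma>) t))
      = sqrt ?a *\<^sub>R (?u /\<^sub>R sqrt (norm ?u))"
    using a by (simp add: real_sqrt_mult divide_simps)
  obtain V where V: "parallel_field p V" "V (\<gamma> t) = ?u /\<^sub>R sqrt (norm ?u)"
    using parallel_field_exists[OF p \<gamma>t normalized_velocity_in_tangent_space[OF p \<gamma>t]] .
  \<comment> \<open>The factor \<open>sqrt ?a\<close> is frozen at the time \<open>t\<close>, so it
    is constant along the field and preserves parallelism.\<close>
  have "parallel_field (p \<circ> \<gamma>) (\<lambda>u. sqrt ?a *\<^sub>R (V \<circ> \<gamma>) u)"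
    by (intro parallel_field_scaleR parallel_field_reparam V smooth range)
  from parallel_transport_eq[OF this t, of 0] parallel_transport_eq[OF V(1) \<gamma>t, of 0]
  show ?thesis
    using V(2) \<open>\<gamma> 0 = 0\<close> by (simp only: tsrvc_def vel) simp
qed

text \<open>
  If \<open>f\<close> is not integrable then neither is the left integrand, and both integrals have the junk
  value \<open>0\<close>.
\<close>

lemma integral_reparam:
  fixes f :: "real \<Rightarrow> real"
  assumes \<gamma>: "\<gamma> \<in> positive_diffeos_01" and nonneg: "\<And>t. t \<in> {0..1} \<Longrightarrow> f t \<ge> 0"
  shows "integral {0..1} (\<lambda>t. velocity \<gamma> t * f (\<gamma> t)) = integral {0..1} f"
proof -
  note pos = positive_diffeos_01_velocity_pos[OF \<gamma>] and range = positive_diffeos_01_range[OF \<gamma>]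
  let ?h = "\<lambda>t. \<bar>velocity \<gamma> t\<bar> * f (\<gamma> t)"
  have smooth: "smooth_on_01 \<gamma>"
    using \<gamma> by (simp add: positive_diffeos_01_def)
  \<comment> \<open>Change of variables for the injective map \<open>\<gamma>\<close> of
    \<open>{0..1}\<close> onto itself. Keeping \<open>b\<close> arbitrary transfers absolute
    integrability in both directions together with the value.\<close>
  have iff: "?h absolutely_integrable_on {0..1} \<and> integral {0..1} ?h = b \<longleftrightarrow>
      f absolutely_integrable_on {0..1} \<and> integral {0..1} f = b" for b
  proof -
    have "(\<gamma> has_field_derivative velocity \<gamma> t) (at t within {0..1})" if "t \<in> {0..1}" for t
      using smooth_on_01_has_velocity[OF smooth that]
      by (simp add: has_real_derivative_iff_has_vector_derivative)
    from has_absolute_integral_change_of_variables_1'[OF _ this range(2), of f b] range(1)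
    show ?thesis by simp
  qed
  have zero: "integral {0..1} g = 0"
    if "\<not> g absolutely_integrable_on {0..1}" "\<And>t. t \<in> {0..1} \<Longrightarrow> g t \<ge> 0" for g :: "real \<Rightarrow> real"
    using that nonnegative_absolutely_integrable_1 not_integrable_integral by blast
  have "integral {0..1} ?h = integral {0..1} f"
  proof (cases "f absolutely_integrable_on {0..1}")
    case True
    then show ?thesis using iff by blast
  next
    case False
    then have "\<not> ?h absolutely_integrable_on {0..1}"
      using iff by blast
    moreover have "0 \<le> ?h t" if "t \<in> {0..1}" for t
    proof -
      have "0 \<le> f (\<gamma> t)"
        using that range(1) nonneg by blast
      then show ?thesis by simp
    qed
    ultimately show ?thesis
      using zero False nonneg by simp
  qed
  moreover have "integral {0..1} ?h = integral {0..1} (\<lambda>t. velocity \<gamma> t * f (\<gamma> t))"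
    by (intro integral_cong) (simp add: abs_of_pos[OF pos])
  ultimately show ?thesis by simp
qed

section \<open>Invariance of the distance under reparametrization\<close>

theorem theorem1:
  fixes p\<^sub>0 p \<beta> :: "real \<Rightarrow> real ^ 3" and \<gamma> :: "real \<Rightarrow> real"
    and x\<^sub>0 x :: "real ^ 3" and q\<^sub>0 q :: "real \<Rightarrow> real ^ 3"
  assumes "smooth_S2_curve p\<^sub>0" and "smooth_S2_curve p"
    and "tsrvc_rep p\<^sub>0 = (x\<^sub>0, q\<^sub>0)" and "tsrvc_rep p = (x, q)"
    and "smooth_S2_curve \<beta>" and "\<beta> 0 = x\<^sub>0" and "\<beta> 1 = x"
    and "\<gamma> \<in> positive_diffeos_01"
  shows "curve_dist \<beta> p\<^sub>0 p = curve_dist \<beta> (p\<^sub>0 \<circ> \<gamma>) (p \<circ> \<gamma>) \<and>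
         curve_dist \<beta> (p\<^sub>0 \<circ> \<gamma>) (p \<circ> \<gamma>) =
           bundle_dist \<beta>
             (x\<^sub>0, \<lambda>t. sqrt (velocity \<gamma> t) *\<^sub>R q\<^sub>0 (\<gamma> t))
             (x, \<lambda>t. sqrt (velocity \<gamma> t) *\<^sub>R q (\<gamma> t))"
proof -
  note \<gamma> = \<open>\<gamma> \<in> positive_diffeos_01\<close>
  have q\<^sub>0: "x\<^sub>0 = p\<^sub>0 0" "q\<^sub>0 = tsrvc p\<^sub>0" and q: "x = p 0" "q = tsrvc p"
    using assms(3,4) by (auto simp: tsrvc_rep_def)
  let ?T = "parallel_transport \<beta> 0 1"
  let ?f = "\<lambda>t. (norm (?T (q\<^sub>0 t) - q t))\<^sup>2"
  \<comment> \<open>\<open>?f\<close> is the integrand for the original curves and \<open>?h\<close>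
    the one for the explicit pair. By \<open>tsrvc_reparam\<close>, \<open>?h\<close> also serves
    the reparametrized curves, and the length term is common to all three distances.\<close>
  let ?h = "\<lambda>t. (norm (?T (sqrt (velocity \<gamma> t) *\<^sub>R q\<^sub>0 (\<gamma> t)) - sqrt (velocity \<gamma> t) *\<^sub>R q (\<gamma> t)))\<^sup>2"
  have "integral {0..1} (\<lambda>t. (norm (?T (tsrvc (p\<^sub>0 \<circ> \<gamma>) t) - tsrvc (p \<circ> \<gamma>) t))\<^sup>2) = integral {0..1} ?h"
    using assms(1,2) \<gamma> by (intro integral_cong) (simp add: tsrvc_reparam q\<^sub>0 q)
  then have "curve_dist \<beta> (p\<^sub>0 \<circ> \<gamma>) (p \<circ> \<gamma>) = sqrt ((curve_length \<beta>)\<^sup>2 + integral {0..1} ?h)"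
    by (simp add: curve_dist_def bundle_dist_def tsrvc_rep_def)
  moreover have "integral {0..1} ?h = integral {0..1} ?f"
  proof -
    \<comment> \<open>Transport along \<open>\<beta>\<close> commutes with the factor
      \<open>sqrt (velocity \<gamma> t)\<close>, which therefore leaves the squared norm as
      \<open>velocity \<gamma> t\<close>, the Jacobian in \<open>integral_reparam\<close>.\<close>
    have "?h t = velocity \<gamma> t * ?f (\<gamma> t)" if t: "t \<in> {0..1}" for t
    proof -
      have "q\<^sub>0 (\<gamma> t) \<in> tangent_space (\<beta> 0)"
        using tsrvc_in_tangent_space[OF assms(1)] positive_diffeos_01_range(1)[OF \<gamma>] t
        unfolding assms(6) q\<^sub>0 by blast
      then have "?T (sqrt (velocity \<gamma> t) *\<^sub>R q\<^sub>0 (\<gamma> t)) = sqrt (velocity \<gamma> t) *\<^sub>R ?T (q\<^sub>0 (\<gamma> t))"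
        using parallel_transport_scaleR[OF assms(5)] by simp
      then show ?thesis
        using positive_diffeos_01_velocity_pos[OF \<gamma> t]
        by (simp add: scaleR_diff_right[symmetric] power_mult_distrib del: scaleR_diff_right)
    qed
    then have "integral {0..1} ?h = integral {0..1} (\<lambda>t. velocity \<gamma> t * ?f (\<gamma> t))"
      by (intro integral_cong)
    also have "\<dots> = integral {0..1} ?f"
      by (rule integral_reparam[OF \<gamma>]) simp
    finally show ?thesis .
  qed
  ultimately show ?thesis
    unfolding curve_dist_def bundle_dist_def tsrvc_rep_def q\<^sub>0 q by simp
qed

end
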